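(* Let $r\ge3$ and let $z\in\mathcal A_r$ be written in the form $z=v+M$, where $v\in\mathbb R$ and $M\in\mathcal I_r:=\{\eta\in\mathcal A_r:\mathrm{Re}(\eta)=0\}$. Then $$\exp(z)=\exp(v)\exp(M),\qquad\text{where}\quad \exp(M)=\cos|M|+\frac{\sin|M|}{|M|}\,M$$ for $M\ne0$, and $\exp(0)=1$.
   Context: Cayley–Dickson algebras: $\mathcal A_0=\mathbb R$, $\mathcal A_1=\mathbb C$, $\mathcal A_2=\mathbb H$, $\mathcal A_3=\mathbb K$ (octonions); $\mathcal A_{r+1}$ consists of $a+bl$ with $a,b\in\mathcal A_r$, $l^2=-1$, product $(\alpha+\beta l)(\gamma+\delta l)=(\alpha\gamma-\tilde\delta\beta)+(\delta\alpha+\beta\tilde\gamma)l$ and conjugation $\widetilde{a+bl}=\tilde a-bl$; $|z|^2=z\tilde z$, $\mathrm{Re}(z)=(z+\tilde z)/2$. These algebras are power-associative, so $z^n$ is well defined, and $\exp(z):=\sum_{n=0}^\infty z^n/n!$. *)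

theory Defs
  imports "HOL-Analysis.Analysis" "HOL-Library.Function_Algebras"
begin

text \<open>
  An element of the Cayley--Dickson algebra \<open>A\<^sub>r\<close> is encoded by its \<open>2 ^ r\<close> real coordinates, as a
  function \<^typ>\<open>nat \<Rightarrow> real\<close> that vanishes outside \<open>{..<2 ^ r}\<close>. The element \<open>a + b l\<close> of
  \<open>A\<^bsub>r+1\<^esub>\<close> has the coordinates of \<open>a\<close> at the positions \<open>0, \<dots>, 2 ^ r - 1\<close> and those of \<open>b\<close> at the
  positions \<open>2 ^ r, \<dots>, 2 ^ (r + 1) - 1\<close>. In particular \<open>A\<^sub>r\<close> sits inside \<open>A\<^bsub>r+1\<^esub>\<close> as the same
  set of functions.

  Addition, negation and zero are the pointwise ones from \<^theory>\<open>HOL-Library.Function_Algebras\<close>,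
  and limits are taken in the product topology on \<^typ>\<open>nat \<Rightarrow> real\<close>, which induces the Euclidean
  topology on the finite-dimensional subspace \<open>A\<^sub>r\<close>. The pointwise product \<open>*\<close> and the constant
  function \<open>1\<close> that are also declared there are not the algebra operations and are not used.
\<close>

type_synonym cd = "nat \<Rightarrow> real"

definition cd_carrier :: "nat \<Rightarrow> cd set" where
  "cd_carrier r = {z. \<forall>i\<ge>2 ^ r. z i = 0}"

definition cd_scale :: "real \<Rightarrow> cd \<Rightarrow> cd" where
  "cd_scale c z = (\<lambda>i. c * z i)"

definition cd_of_real :: "real \<Rightarrow> cd" where
  "cd_of_real c = (\<lambda>i. if i = 0 then c else 0)"

text \<open>For \<open>z = a + b l\<close> in \<open>A\<^bsub>r+1\<^esub>\<close>: \<open>cd_fst r z = a\<close>, \<open>cd_snd r z = b\<close>, \<open>cd_join r a b = z\<close>.\<close>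

definition cd_fst :: "nat \<Rightarrow> cd \<Rightarrow> cd" where
  "cd_fst r z = (\<lambda>i. if i < 2 ^ r then z i else 0)"

definition cd_snd :: "nat \<Rightarrow> cd \<Rightarrow> cd" where
  "cd_snd r z = (\<lambda>i. if i < 2 ^ r then z (i + 2 ^ r) else 0)"

definition cd_join :: "nat \<Rightarrow> cd \<Rightarrow> cd \<Rightarrow> cd" where
  "cd_join r a b = (\<lambda>i. if i < 2 ^ r then a i else if i < 2 ^ Suc r then b (i - 2 ^ r) else 0)"

primrec cd_conj :: "nat \<Rightarrow> cd \<Rightarrow> cd" where
  "cd_conj 0 z = z"
| "cd_conj (Suc r) z = cd_join r (cd_conj r (cd_fst r z)) (- cd_snd r z)"

primrec cd_mult :: "nat \<Rightarrow> cd \<Rightarrow> cd \<Rightarrow> cd" where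
  "cd_mult 0 x y = cd_of_real (x 0 * y 0)"
| "cd_mult (Suc r) x y =
    (let \<alpha> = cd_fst r x; \<beta> = cd_snd r x; \<gamma> = cd_fst r y; \<delta> = cd_snd r y in
      cd_join r (cd_mult r \<alpha> \<gamma> - cd_mult r (cd_conj r \<delta>) \<beta>)
                (cd_mult r \<delta> \<alpha> + cd_mult r \<beta> (cd_conj r \<gamma>)))"

text \<open>\<open>Re z\<close> as an element of \<open>A\<^sub>r\<close>.\<close>

definition cd_Re :: "nat \<Rightarrow> cd \<Rightarrow> cd" where
  "cd_Re r z = cd_scale (1 / 2) (z + cd_conj r z)"

definition cd_imag :: "nat \<Rightarrow> cd set" where
  "cd_imag r = {\<eta> \<in> cd_carrier r. cd_Re r \<eta> = 0}"

definition cd_abs :: "nat \<Rightarrow> cd \<Rightarrow> real" where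
  "cd_abs r z = (THE t. t \<ge> 0 \<and> cd_of_real (t\<^sup>2) = cd_mult r z (cd_conj r z))"

text \<open>
  The algebras are power-associative, so the bracketing chosen here is immaterial.
\<close>

primrec cd_power :: "nat \<Rightarrow> cd \<Rightarrow> nat \<Rightarrow> cd" where
  "cd_power r z 0 = cd_of_real 1"
| "cd_power r z (Suc n) = cd_mult r z (cd_power r z n)"

definition cd_exp_term :: "nat \<Rightarrow> cd \<Rightarrow> nat \<Rightarrow> cd" where
  "cd_exp_term r z n = cd_scale (1 / fact n) (cd_power r z n)"

definition cd_exp :: "nat \<Rightarrow> cd \<Rightarrow> cd" where
  "cd_exp r z = (\<Sum>n. cd_exp_term r z n)"

end

theory Submission
  imports Defs
begin

text \<open>
  If \<open>U\<close> is purely imaginary with \<open>|U| = 1\<close>, then \<open>U\<^sup>2 = -1\<close>, so \<open>a + b i \<mapsto> a + b U\<close> is a continuous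
  linear and multiplicative embedding of \<open>\<complex>\<close>, and it carries the complex exponential to that of
  \<open>A\<^sub>r\<close>. Every \<open>z = v + M\<close> lies in the image of such an embedding: take \<open>U = M / |M|\<close>, or any
  imaginary unit if \<open>M = 0\<close>.
\<close>

section \<open>Linear structure\<close>

lemma cd_join_add: "cd_join r (a + a') (b + b') = cd_join r a b + cd_join r a' b'"
  by (auto simp: cd_join_def fun_eq_iff)

lemma cd_join_scale: "cd_join r (cd_scale c a) (cd_scale c b) = cd_scale c (cd_join r a b)"
  by (auto simp: cd_join_def cd_scale_def fun_eq_iff)

lemma cd_fst_add [simp]: "cd_fst r (x + y) = cd_fst r x + cd_fst r y"
  and cd_snd_add [simp]: "cd_snd r (x + y) = cd_snd r x + cd_snd r y"
  and cd_fst_scale [simp]: "cd_fst r (cd_scale c x) = cd_scale c (cd_fst r x)"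
  and cd_snd_scale [simp]: "cd_snd r (cd_scale c x) = cd_scale c (cd_snd r x)"
  by (auto simp: cd_fst_def cd_snd_def cd_scale_def fun_eq_iff)

lemma cd_fst_of_real [simp]: "cd_fst r (cd_of_real c) = cd_of_real c"
  and cd_snd_of_real [simp]: "cd_snd r (cd_of_real c) = 0"
  by (auto simp: cd_fst_def cd_snd_def cd_of_real_def fun_eq_iff)

lemma cd_fst_carrier [simp]: "cd_fst r x \<in> cd_carrier r"
  and cd_snd_carrier [simp]: "cd_snd r x \<in> cd_carrier r"
  by (auto simp: cd_fst_def cd_snd_def cd_carrier_def)

lemma cd_fst_join: "a \<in> cd_carrier r \<Longrightarrow> cd_fst r (cd_join r a b) = a"
  and cd_snd_join: "b \<in> cd_carrier r \<Longrightarrow> cd_snd r (cd_join r a b) = b"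
  by (auto simp: cd_fst_def cd_snd_def cd_join_def cd_carrier_def fun_eq_iff)

lemma cd_join_fst_snd: "x \<in> cd_carrier (Suc r) \<Longrightarrow> cd_join r (cd_fst r x) (cd_snd r x) = x"
  by (auto simp: cd_fst_def cd_snd_def cd_join_def cd_carrier_def fun_eq_iff)

lemma cd_join_of_real: "cd_join r (cd_of_real c) 0 = cd_of_real c"
  by (auto simp: cd_join_def cd_of_real_def fun_eq_iff)

lemma cd_scale_simps [simp]:
  "cd_scale c 0 = 0" "cd_scale 0 x = 0" "cd_scale 1 x = x"
  "cd_scale c (- x) = - cd_scale c x" "cd_scale c (cd_scale d x) = cd_scale (c * d) x"
  "cd_scale c (cd_of_real d) = cd_of_real (c * d)"
  by (auto simp: cd_scale_def cd_of_real_def fun_eq_iff)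

lemma cd_scale_add: "cd_scale c (x + y) = cd_scale c x + cd_scale c y"
  and cd_scale_diff: "cd_scale c (x - y) = cd_scale c x - cd_scale c y"
  by (auto simp: cd_scale_def fun_eq_iff algebra_simps)

lemma cd_of_real_0 [simp]: "cd_of_real 0 = 0"
  by (auto simp: cd_of_real_def)

lemma cd_of_real_carrier [simp]: "cd_of_real c \<in> cd_carrier r"
  by (auto simp: cd_of_real_def cd_carrier_def)

lemma cd_carrier_uminus: "x \<in> cd_carrier r \<Longrightarrow> - x \<in> cd_carrier r"
  and cd_carrier_scale: "x \<in> cd_carrier r \<Longrightarrow> cd_scale c x \<in> cd_carrier r"
  by (auto simp: cd_carrier_def cd_scale_def)

section \<open>Conjugation and multiplication\<close>

text \<open>Each doubling negates the second half outright, so only coordinate 0 keeps its sign.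
  Outside the carrier's positions both sides vanish; at \<open>r = 0\<close> this is what reconciles
  the identity map with the sign change.\<close>

lemma cd_conj_eq:
  "z \<in> cd_carrier r \<Longrightarrow> cd_conj r z = (\<lambda>i. if i = 0 then z i else - z i)"
proof (induction r arbitrary: z)
  case 0
  then show ?case by (auto simp: cd_carrier_def fun_eq_iff)
next
  case (Suc r)
  have "cd_conj (Suc r) z = cd_join r (\<lambda>i. if i = 0 then cd_fst r z i else - cd_fst r z i) (- cd_snd r z)"
    using Suc.IH[of "cd_fst r z"] by simp
  also have "\<dots> = (\<lambda>i. if i = 0 then z i else - z i)"
    using Suc.prems by (auto simp: cd_join_def cd_fst_def cd_snd_def cd_carrier_def fun_eq_iff)
  finally show ?case .
qed

lemma cd_conj_carrier [simp]: "z \<in> cd_carrier r \<Longrightarrow> cd_conj r z \<in> cd_carrier r"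
  by (auto simp: cd_conj_eq cd_carrier_def)

lemma cd_conj_conj: "z \<in> cd_carrier r \<Longrightarrow> cd_conj r (cd_conj r z) = z"
  by (subst cd_conj_eq[OF cd_conj_carrier]) (auto simp: cd_conj_eq)

lemma cd_conj_of_real [simp]: "cd_conj r (cd_of_real c) = cd_of_real c"
  by (subst cd_conj_eq[OF cd_of_real_carrier]) (auto simp: cd_of_real_def)

lemma cd_conj_zero [simp]: "cd_conj r 0 = 0"
  using cd_conj_of_real[of r 0] by simp

lemma cd_conj_add: "cd_conj r (x + y) = cd_conj r x + cd_conj r y"
  by (induction r arbitrary: x y) (simp_all flip: cd_join_add)

lemma cd_conj_scale: "cd_conj r (cd_scale c x) = cd_scale c (cd_conj r x)"
  by (induction r arbitrary: x) (auto simp flip: cd_join_scale)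

text \<open>The doubling formula reverses some factors: \<alpha> stands on the left in one product
  and on the right in another. Each side at \<open>Suc r\<close> therefore needs both sides at
  \<open>r\<close>, so the two are proved together.\<close>

lemma cd_mult_add_both:
  "cd_mult r (x + x') y = cd_mult r x y + cd_mult r x' y \<and>
   cd_mult r y (x + x') = cd_mult r y x + cd_mult r y x'"
proof (induction r arbitrary: x x' y)
  case 0
  show ?case by (auto simp: cd_of_real_def fun_eq_iff algebra_simps)
next
  case (Suc r)
  show ?case
    by (simp only: cd_mult.simps Let_def cd_fst_add cd_snd_add cd_conj_add Suc.IH)
      (simp add: cd_join_def fun_eq_iff)
qed

lemmas cd_mult_add_left = cd_mult_add_both[THEN conjunct1]
  and cd_mult_add_right = cd_mult_add_both[THEN conjunct2]

lemma cd_mult_scale_both: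
  "cd_mult r (cd_scale c x) y = cd_scale c (cd_mult r x y) \<and>
   cd_mult r y (cd_scale c x) = cd_scale c (cd_mult r y x)"
proof (induction r arbitrary: x y)
  case 0
  show ?case by (auto simp: cd_of_real_def cd_scale_def fun_eq_iff)
next
  case (Suc r)
  then show ?case
    by (simp add: Let_def cd_conj_scale cd_scale_add cd_scale_diff flip: cd_join_scale)
qed

lemmas cd_mult_scale_left = cd_mult_scale_both[THEN conjunct1]
  and cd_mult_scale_right = cd_mult_scale_both[THEN conjunct2]

lemma cd_mult_zero_left [simp]: "cd_mult r 0 y = 0"
  using cd_mult_scale_left[of r 0 0 y] by simp

lemma cd_mult_zero_right [simp]: "cd_mult r x 0 = 0"
  using cd_mult_scale_right[of r x 0 0] by simp

lemma cd_mult_uminus_left: "cd_mult r (- x) y = - cd_mult r x y"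
  using cd_mult_scale_left[of r "-1" x y] by (simp add: cd_scale_def[abs_def] fun_Compl_def)

lemma cd_mult_uminus_right: "cd_mult r x (- y) = - cd_mult r x y"
  using cd_mult_scale_right[of r x "-1" y] by (simp add: cd_scale_def[abs_def] fun_Compl_def)

text \<open>Centrality of the reals. The two sides go through one induction because the
  \<open>l\<close> part of a left multiple is \<delta> times the real, a right multiple one level
  down.\<close>

lemma cd_mult_of_real_both:
  "x \<in> cd_carrier r \<Longrightarrow>
    cd_mult r (cd_of_real c) x = cd_scale c x \<and> cd_mult r x (cd_of_real c) = cd_scale c x"
proof (induction r arbitrary: x)
  case 0
  then show ?case by (auto simp: cd_of_real_def cd_scale_def cd_carrier_def fun_eq_iff)
next
  case (Suc r)
  then show ?case by (simp add: Let_def cd_join_scale cd_join_fst_snd)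
qed

lemmas cd_mult_of_real_left = cd_mult_of_real_both[THEN conjunct1]
  and cd_mult_of_real_right = cd_mult_of_real_both[THEN conjunct2]

section \<open>The norm\<close>

text \<open>Given by coordinates rather than by the product, so that positivity and definiteness are
  immediate; \<open>cd_mult_conj_both\<close> supplies the link to the product.\<close>

definition cd_sqnorm :: "nat \<Rightarrow> cd \<Rightarrow> real" where
  "cd_sqnorm r z = (\<Sum>i<2 ^ r. (z i)\<^sup>2)"

lemma cd_sqnorm_Suc: "cd_sqnorm (Suc r) z = cd_sqnorm r (cd_fst r z) + cd_sqnorm r (cd_snd r z)"
proof -
  \<comment> \<open>The two halves of the index range hold the coordinates of the two
    components.\<close>
  have "(\<Sum>i<n + n. f i) = (\<Sum>i<n. f i) + (\<Sum>i<n. f (i + n))" for n and f :: "nat \<Rightarrow> real"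
    using sum.atLeastLessThan_concat[of 0 n "n + n" f] sum.shift_bounds_nat_ivl[of f 0 n n]
    by (simp add: lessThan_atLeast0)
  then show ?thesis
    by (simp add: cd_sqnorm_def cd_fst_def cd_snd_def mult_2)
qed

lemma cd_sqnorm_scale: "cd_sqnorm r (cd_scale c z) = c\<^sup>2 * cd_sqnorm r z"
  by (simp add: cd_sqnorm_def cd_scale_def power_mult_distrib sum_distrib_left)

lemma cd_sqnorm_nonneg: "cd_sqnorm r z \<ge> 0"
  by (simp add: cd_sqnorm_def sum_nonneg)

lemma cd_sqnorm_eq_0_iff: "z \<in> cd_carrier r \<Longrightarrow> cd_sqnorm r z = 0 \<longleftrightarrow> z = 0"
  by (auto simp: cd_sqnorm_def cd_carrier_def sum_nonneg_eq_0_iff fun_eq_iff)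
    (metis lessThan_iff not_le)

text \<open>In the first product the \<open>l\<close> part is
  \<open>- \<beta> \<alpha> + \<beta> \<alpha> = 0\<close>, and the remaining part is \<alpha> times
  its conjugate plus the conjugate of \<beta> times \<beta>. These occur in opposite orders, hence
  the joint induction.\<close>

lemma cd_mult_conj_both:
  "z \<in> cd_carrier r \<Longrightarrow>
    cd_mult r z (cd_conj r z) = cd_of_real (cd_sqnorm r z) \<and>
    cd_mult r (cd_conj r z) z = cd_of_real (cd_sqnorm r z)"
proof (induction r arbitrary: z)
  case 0
  then show ?case by (simp add: cd_sqnorm_def power2_eq_square)
next
  case (Suc r)
  have of_real_add: "cd_of_real (a + b) = cd_of_real a + cd_of_real b" for a b
    by (auto simp: cd_of_real_def fun_eq_iff)
  have conj_uminus: "cd_conj r (- x) = - cd_conj r x" for x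
    using cd_conj_scale[of r "-1" x] by (simp add: cd_scale_def[abs_def] fun_Compl_def)
  show ?case
    by (simp add: Let_def cd_fst_join cd_snd_join cd_carrier_uminus cd_conj_conj conj_uminus
        Suc.IH cd_mult_uminus_left cd_mult_uminus_right cd_sqnorm_Suc cd_join_of_real
        flip: of_real_add)
qed

text \<open>Resolves the definite description: \<open>cd_of_real\<close> is injective, and a
  nonnegative real has exactly one nonnegative square root.\<close>

lemma cd_abs_eq_sqrt:
  assumes "z \<in> cd_carrier r"
  shows "cd_abs r z = sqrt (cd_sqnorm r z)"
proof -
  have inj: "cd_of_real a = cd_of_real b \<longleftrightarrow> a = b" for a b
    by (auto simp: cd_of_real_def fun_eq_iff)
  show ?thesis
    unfolding cd_abs_def using cd_mult_conj_both[OF assms] cd_sqnorm_nonneg[of r z]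
    by (intro the_equality) (auto simp: inj intro: real_sqrt_unique[symmetric])
qed

text \<open>Adding the conjugate doubles coordinate 0 and cancels all others.\<close>

lemma cd_imag_iff: "M \<in> cd_imag r \<longleftrightarrow> M \<in> cd_carrier r \<and> M 0 = 0"
  by (auto simp: cd_imag_def cd_Re_def cd_conj_eq cd_scale_def fun_eq_iff dest: spec[of _ 0])

text \<open>Conjugation is negation on imaginary elements, so the square is minus the product with
  the conjugate.\<close>

lemma cd_imag_mult_self:
  assumes "M \<in> cd_imag r"
  shows "cd_mult r M M = cd_of_real (- cd_sqnorm r M)"
proof -
  have "M \<in> cd_carrier r" and "cd_conj r M = - M"
    using assms by (auto simp: cd_imag_iff cd_conj_eq fun_eq_iff)
  then have "- cd_mult r M M = cd_of_real (cd_sqnorm r M)"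
    using cd_mult_conj_both[of M r] by (simp add: cd_mult_uminus_right)
  then have "cd_mult r M M = - cd_of_real (cd_sqnorm r M)"
    by (metis minus_minus)
  then show ?thesis
    by (auto simp: cd_of_real_def fun_eq_iff)
qed

text \<open>Including \<open>M = 0\<close> lets the main proof treat all \<open>M\<close> at
  once.\<close>

lemma cd_polar:
  assumes "M \<in> cd_imag r" and "r \<ge> 1"
  obtains U where "U \<in> cd_imag r" "cd_sqnorm r U = 1" "M = cd_scale (cd_abs r M) U"
proof (cases "M = 0")
  case True
  \<comment> \<open>The image in \<open>A\<^sub>r\<close> of the imaginary unit of \<complex>;
    position 1 exists because \<open>r \<ge> 1\<close>.\<close>
  define U :: cd where "U = (\<lambda>i. if i = 1 then 1 else 0)"
  have "(1::nat) < 2 ^ r"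
    using assms(2) by (intro one_less_power) auto
  then have "U \<in> cd_imag r"
    by (auto simp: cd_imag_iff cd_carrier_def U_def)
  moreover have "cd_sqnorm r U = (\<Sum>i\<in>{..<2 ^ r :: nat}. if i = 1 then 1 else 0)"
    unfolding cd_sqnorm_def U_def by (intro sum.cong) auto
  with \<open>1 < 2 ^ r\<close> have "cd_sqnorm r U = 1"
    by simp
  moreover have "cd_abs r M = 0"
    using True assms(1) by (simp add: cd_imag_iff cd_abs_eq_sqrt cd_sqnorm_eq_0_iff)
  ultimately show ?thesis
    using True that by simp
next
  case False
  have M: "M \<in> cd_carrier r" "M 0 = 0"
    using assms(1) by (auto simp: cd_imag_iff)
  then have abs: "(cd_abs r M)\<^sup>2 = cd_sqnorm r M" "cd_abs r M \<noteq> 0"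
    using False by (simp_all add: cd_abs_eq_sqrt cd_sqnorm_nonneg cd_sqnorm_eq_0_iff)
  show ?thesis
  proof
    show "cd_scale (1 / cd_abs r M) M \<in> cd_imag r"
      using M by (auto simp: cd_imag_iff cd_carrier_scale) (simp add: cd_scale_def)
    show "cd_sqnorm r (cd_scale (1 / cd_abs r M) M) = 1"
      using abs by (simp add: cd_sqnorm_scale power_divide flip: abs(1))
    show "M = cd_scale (cd_abs r M) (cd_scale (1 / cd_abs r M) M)"
      using abs by simp
  qed
qed

section \<open>Complex lines\<close>

text \<open>Sends \<open>\<i>\<close> to \<open>U\<close>; it becomes multiplicative once
  \<open>U\<close> is an imaginary unit.\<close>

definition cd_of_complex :: "cd \<Rightarrow> complex \<Rightarrow> cd" where
  "cd_of_complex U w = cd_of_real (Re w) + cd_scale (Im w) U"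

lemma cd_of_complex_scale: "cd_scale c (cd_of_complex U w) = cd_of_complex U (of_real c * w)"
  by (simp add: cd_of_complex_def cd_scale_add)

text \<open>Bilinear expansion leaves only products with a real factor and \<open>U U = -1\<close>,
  as in \<complex>.\<close>

lemma cd_of_complex_mult:
  assumes "U \<in> cd_imag r" and "cd_sqnorm r U = 1"
  shows "cd_mult r (cd_of_complex U w) (cd_of_complex U w') = cd_of_complex U (w * w')"
proof -
  have "U \<in> cd_carrier r" and "cd_mult r U U = cd_of_real (- 1)"
    using assms cd_imag_mult_self[of U r] by (auto simp: cd_imag_iff)
  then show ?thesis
    by (simp add: cd_of_complex_def cd_mult_add_left cd_mult_add_right cd_mult_scale_left
        cd_mult_scale_right cd_mult_of_real_left cd_mult_of_real_right cd_carrier_scale)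
      (auto simp: cd_of_real_def cd_scale_def fun_eq_iff algebra_simps)
qed

lemma cd_of_complex_power:
  assumes "U \<in> cd_imag r" and "cd_sqnorm r U = 1"
  shows "cd_power r (cd_of_complex U w) n = cd_of_complex U (w ^ n)"
proof (induction n)
  case 0
  show ?case by (simp add: cd_of_complex_def)
next
  case (Suc n)
  then show ?case by (simp add: cd_of_complex_mult[OF assms])
qed

text \<open>The embedding maps complex partial sums to partial sums here, and continuity carries the
  limit over. The \<open>sums\<close> form yields both convergence and value.\<close>

lemma cd_exp_sums_of_complex:
  assumes "U \<in> cd_imag r" and "cd_sqnorm r U = 1"
  shows "cd_exp_term r (cd_of_complex U w) sums cd_of_complex U (exp w)"
proof -
  define f where "f n = w ^ n /\<^sub>R fact n" for n
  have exp_term: "cd_exp_term r (cd_of_complex U w) n = cd_of_complex U (f n)" for n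
    unfolding cd_exp_term_def cd_of_complex_power[OF assms] cd_of_complex_scale f_def
    by (simp add: scaleR_conv_of_real field_simps)
  have sum: "(\<Sum>k<n. cd_of_complex U (f k)) = cd_of_complex U (\<Sum>k<n. f k)" for n
    by (induction n)
      (auto simp: cd_of_complex_def cd_scale_def cd_of_real_def fun_eq_iff algebra_simps)
  have f: "(\<lambda>n. \<Sum>k<n. f k) \<longlonglongrightarrow> exp w"
    using exp_converges[of w] by (simp add: sums_def f_def)
  \<comment> \<open>Limits are taken in the product topology, so continuity is checked by
    coordinates; the real part contributes to coordinate 0 only.\<close>
  have "continuous_on UNIV (\<lambda>w. cd_of_complex U w i)" for i
    by (cases "i = 0")
      (auto simp: cd_of_complex_def cd_of_real_def cd_scale_def intro!: continuous_intros)
  then have cont: "continuous_on UNIV (cd_of_complex U)"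
    by (rule continuous_on_coordinatewise_then_product)
  have "(\<lambda>n. cd_of_complex U (\<Sum>k<n. f k)) \<longlonglongrightarrow> cd_of_complex U (exp w)"
    by (rule continuous_on_tendsto_compose[OF cont f]) simp_all
  then show ?thesis
    by (simp add: sums_def exp_term sum)
qed

lemma cd_exp_of_complex:
  assumes "U \<in> cd_imag r" and "cd_sqnorm r U = 1"
  shows "cd_exp r (cd_of_complex U w) = cd_of_complex U (exp w)"
  using sums_unique[OF cd_exp_sums_of_complex[OF assms]] by (simp add: cd_exp_def)

theorem proposition3p2:
  fixes r :: nat and z M :: cd and v :: real
  assumes "r \<ge> 3"
    and "z \<in> cd_carrier r"
    and "M \<in> cd_imag r"
    and "z = cd_of_real v + M"
  shows "summable (cd_exp_term r z) \<and>
    cd_exp r z = cd_mult r (cd_exp r (cd_of_real v)) (cd_exp r M) \<and>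
    cd_exp r (cd_of_real v) = cd_of_real (exp v) \<and>
    (M \<noteq> 0 \<longrightarrow>
      cd_exp r M = cd_of_real (cos (cd_abs r M)) + cd_scale (sin (cd_abs r M) / cd_abs r M) M) \<and>
    cd_exp r 0 = cd_of_real 1"
proof -
  define m where "m = cd_abs r M"
  have "r \<ge> 1"
    using assms(1) by simp
  then obtain U where U: "U \<in> cd_imag r" "cd_sqnorm r U = 1" and M: "M = cd_scale m U"
    using cd_polar[OF assms(3)] unfolding m_def by blast
  note exp = cd_exp_of_complex[OF U]
  have z: "z = cd_of_complex U (Complex v m)"
    by (simp add: cd_of_complex_def M assms(4))
  have M': "M = cd_of_complex U (Complex 0 m)"
    by (simp add: cd_of_complex_def M)
  have real: "cd_of_real x = cd_of_complex U (of_real x)" for x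
    by (simp add: cd_of_complex_def)
  \<comment> \<open>The real number \<open>v\<close>, \<open>M\<close> and \<open>z\<close> lie on
    one complex line, so the functional equation of the complex exponential transfers.\<close>
  have "Complex v m = of_real v + Complex 0 m"
    by (simp add: complex_eq_iff)
  then have "cd_exp r z = cd_mult r (cd_exp r (cd_of_real v)) (cd_exp r M)"
    by (simp add: z M' real exp cd_of_complex_mult[OF U] exp_add)
  moreover have real_exp: "cd_exp r (cd_of_real x) = cd_of_real (exp x)" for x
    by (simp add: real exp exp_of_real)
  moreover have "cd_exp r M = cd_of_real (cos m) + cd_scale (sin m / m) M" if "M \<noteq> 0"
  proof -
    \<comment> \<open>Otherwise \<open>M = cd_scale 0 U = 0\<close>. This allows \<open>m\<close> to
      cancel between \<open>sin m / m\<close> and \<open>M\<close>.\<close>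
    have "m \<noteq> 0"
      using that M by auto
    then have "cd_scale (sin m / m) M = cd_scale (sin m) U"
      by (simp add: M)
    moreover have "cd_exp r M = cd_of_complex U (exp (Complex 0 m))"
      by (simp add: M' exp)
    ultimately show ?thesis
      by (simp add: cd_of_complex_def Re_exp Im_exp)
  qed
  moreover have "cd_exp r 0 = cd_of_real 1"
    using real_exp[of 0] by simp
  moreover have "summable (cd_exp_term r z)"
    using cd_exp_sums_of_complex[OF U] z sums_summable by blast
  ultimately show ?thesis
    by (simp add: m_def)
qed

end
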